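(* Let $n,\ell \geq 1$ be integers and let $M : [\ell]^n \to \mathbf{vec}$ be a functor. Define a function $\gamma : [\ell]^n \to \mathbb{Z}$ by $$\gamma(i) = \sum_{\substack{S \subseteq E\\ i-\Sigma S\,\in\,[\ell]^n}} (-1)^{|S|}\,\dim(M(i-\Sigma S)).$$ Then the following is a minimal Hilbert decomposition of (the Hilbert function of) $\widehat{M}$: $$\left(\ \bigoplus_{\substack{i \in [\ell]^n\\ \gamma(i) > 0}} F_i^{\gamma(i)}\ ,\ \bigoplus_{\substack{i \in [\ell]^n\\ \gamma(i) < 0}} F_i^{-\gamma(i)}\ \right).$$
   Context: Fix a field $\mathbb{k}$. $\mathbf{vec}$ is the category of finite-dimensional $\mathbb{k}$-vector spaces. $\mathbf{R}^n$ is the set $\mathbb{R}^n$ with the product order, viewed as a category; an $n$-parameter persistence module is a functor $\mathbf{R}^n\to\mathbf{vec}$. $[\ell]=\{0,1,\dots,\ell-1\}$ with its usual order, and $[\ell]^n$ has the product order, viewed as a category and as a subset of $\mathbb{R}^n$. $E=\{e_1,\dots,e_n\}$ is the canonical basis of $\mathbb{R}^n$, and for $S\subseteq E$, $\Sigma S=\sum_{e\in S}e\in\mathbb{R}^n$ (with $\Sigma\emptyset=0$). For $M:[\ell]^n\to\mathbf{vec}$, the extension $\widehat{M}:\mathbf{R}^n\to\mathbf{vec}$ is defined by $\widehat{M}(r)=0$ if some coordinate of $r$ is negative, and $\widehat{M}(r)=M(s)$ with $s=\max\{t\in[\ell]^n : t\leq r\}$ otherwise; its structure morphism $\widehat{M}(r)\to\widehat{M}(r')$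 is zero if some coordinate of $r$ is negative, and otherwise it is the structure morphism $M(s)\to M(s')$ with $s=\max\{t\in[\ell]^n : t\leq r\}$, $s'=\max\{t\in[\ell]^n : t\leq r'\}$. For $i\in\mathbb{R}^n$, $F_i$ is the module that is $\mathbb{k}$ on $\{j : j\geq i\}$ and $0$ elsewhere, with identity structure maps inside the support. A module is free if it is isomorphic to a direct sum of modules $F_i$; the barcode $\mathcal{B}(P)$ of a free module is the unique multiset of elements of $\mathbb{R}^n$ with $P\cong\bigoplus_{i\in\mathcal{B}(P)}F_i$, and its cardinality is the rank of $P$. The Hilbert function of a module $N$ is $\mathsf{Hil}(N)(i)=\dim N(i)$. A Hilbert decomposition of $\eta:\mathbb{R}^n\to\mathbb{Z}$ is a pair $(P,Q)$ of free modules of finite rank with $\eta=\mathsf{Hil}(P)-\mathsf{Hil}(Q)$; it is minimal if $\mathcal{B}(P)$ and $\mathcal{B}(Q)$ are disjoint (no common element of $\mathbb{R}^n$). *)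

theory Defs
  imports "HOL-Analysis.Analysis" "HOL-Library.Function_Algebras" "HOL-Library.Multiset"
begin

(* A diagram of vector spaces indexed by a poset is given by subspaces pm_space i of an
   ambient vector space 'v together with maps pm_map i j, of which only the values on
   pm_space i for i \<le> j are relevant. The scalar multiplication of the ambient space is
   a separate argument of the notions below, in the style of the locale vector_space.
   The subspaces at different indices are unrelated, so that up to isomorphism every
   functor into finite-dimensional vector spaces arises (embed into the direct sum). *)

record ('p, 'v) pmodule =
  pm_space :: "'p \<Rightarrow> 'v set"
  pm_map :: "'p \<Rightarrow> 'p \<Rightarrow> 'v \<Rightarrow> 'v"

definition linear_map_on ::
  "('k \<Rightarrow> 'v::ab_group_add \<Rightarrow> 'v) \<Rightarrow> ('k \<Rightarrow> 'w::ab_group_add \<Rightarrow> 'w) \<Rightarrow>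
   'v set \<Rightarrow> 'w set \<Rightarrow> ('v \<Rightarrow> 'w) \<Rightarrow> bool" where
  "linear_map_on s1 s2 V W f \<longleftrightarrow>
     f ` V \<subseteq> W \<and>
     (\<forall>x\<in>V. \<forall>y\<in>V. f (x + y) = f x + f y) \<and>
     (\<forall>c. \<forall>x\<in>V. f (s1 c x) = s2 c (f x))"

(* Functors from the poset I (a full subposet of 'p) to finite-dimensional vector spaces. *)

locale persistence_module = vector_space s
  for s :: "'k::field \<Rightarrow> 'v::ab_group_add \<Rightarrow> 'v" +
  fixes I :: "'p::order set" and M :: "('p, 'v) pmodule"
  assumes subspace_pm_space: "i \<in> I \<Longrightarrow> subspace (pm_space M i)"
    and finite_dim_pm_space: "i \<in> I \<Longrightarrow> \<exists>B. finite B \<and> pm_space M i = span B"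
    and linear_pm_map:
      "\<lbrakk>i \<in> I; j \<in> I; i \<le> j\<rbrakk> \<Longrightarrow>
        linear_map_on s s (pm_space M i) (pm_space M j) (pm_map M i j)"
    and pm_map_id: "\<lbrakk>i \<in> I; x \<in> pm_space M i\<rbrakk> \<Longrightarrow> pm_map M i i x = x"
    and pm_map_comp:
      "\<lbrakk>i \<in> I; j \<in> I; k \<in> I; i \<le> j; j \<le> k; x \<in> pm_space M i\<rbrakk> \<Longrightarrow>
        pm_map M j k (pm_map M i j x) = pm_map M i k x"

definition pm_isomorphic ::
  "('k \<Rightarrow> 'v::ab_group_add \<Rightarrow> 'v) \<Rightarrow> ('p::order, 'v) pmodule \<Rightarrow>
   ('k \<Rightarrow> 'w::ab_group_add \<Rightarrow> 'w) \<Rightarrow> ('p, 'w) pmodule \<Rightarrow> bool" where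
  "pm_isomorphic s1 M s2 N \<longleftrightarrow>
     (\<exists>\<phi>. (\<forall>i. linear_map_on s1 s2 (pm_space M i) (pm_space N i) (\<phi> i) \<and>
               bij_betw (\<phi> i) (pm_space M i) (pm_space N i)) \<and>
          (\<forall>i j. i \<le> j \<longrightarrow>
             (\<forall>x\<in>pm_space M i. \<phi> j (pm_map M i j x) = pm_map N i j (\<phi> i x))))"

definition hilbert_function ::
  "('k::field \<Rightarrow> 'v::ab_group_add \<Rightarrow> 'v) \<Rightarrow> ('p, 'v) pmodule \<Rightarrow> 'p \<Rightarrow> int" where
  "hilbert_function s M i = int (vector_space.dim s (pm_space M i))"

(* The elements of the direct sum over B are the finitely supported families, extended
   by 0 outside B; the scalar multiplication is pointwise. *)

definition fun_scale :: "('k \<Rightarrow> 'v \<Rightarrow> 'v) \<Rightarrow> 'k \<Rightarrow> ('b \<Rightarrow> 'v) \<Rightarrow> ('b \<Rightarrow> 'v)" where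
  "fun_scale s c x = (\<lambda>b. s c (x b))"

definition direct_sum ::
  "'b set \<Rightarrow> ('b \<Rightarrow> ('p, 'v::zero) pmodule) \<Rightarrow> ('p, 'b \<Rightarrow> 'v) pmodule" where
  "direct_sum B N =
     \<lparr>pm_space = (\<lambda>i. {x. (\<forall>b\<in>B. x b \<in> pm_space (N b) i) \<and> (\<forall>b. b \<notin> B \<longrightarrow> x b = 0) \<and>
                          finite {b. x b \<noteq> 0}}),
      pm_map = (\<lambda>i j x b. if b \<in> B then pm_map (N b) i j (x b) else 0)\<rparr>"

definition pm_power :: "('p, 'v::zero) pmodule \<Rightarrow> nat \<Rightarrow> ('p, nat \<Rightarrow> 'v) pmodule" where
  "pm_power N m = direct_sum {..<m} (\<lambda>_. N)"

(* The module F_i; its ambient space is the field itself, with multiplication as scaling. *)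

definition free_gen :: "'p::order \<Rightarrow> ('p, 'k::field) pmodule" where
  "free_gen i =
     \<lparr>pm_space = (\<lambda>j. if i \<le> j then UNIV else {0}),
      pm_map = (\<lambda>j j' x. if i \<le> j then x else 0)\<rparr>"

(* The direct sum of the F_i over a multiset: its indexing set contains, for every i,
   as many pairs (i, m) as the multiplicity of i. *)

definition free_on :: "'p::order multiset \<Rightarrow> ('p, 'p \<times> nat \<Rightarrow> 'k::field) pmodule" where
  "free_on B = direct_sum {(i, m). m < count B i} (\<lambda>(i, m). free_gen i)"

definition has_barcode ::
  "('k::field \<Rightarrow> 'v::ab_group_add \<Rightarrow> 'v) \<Rightarrow> ('p::order, 'v) pmodule \<Rightarrow> 'p multiset \<Rightarrow> bool" where
  "has_barcode s P B \<longleftrightarrow>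
     pm_isomorphic s P (fun_scale (*)) (free_on B :: ('p, 'p \<times> nat \<Rightarrow> 'k) pmodule)"

(* Multisets are finite in HOL, hence the finite rank. *)

definition free_of_finite_rank ::
  "('k::field \<Rightarrow> 'v::ab_group_add \<Rightarrow> 'v) \<Rightarrow> ('p::order, 'v) pmodule \<Rightarrow> bool" where
  "free_of_finite_rank s P \<longleftrightarrow>
     persistence_module s UNIV P \<and> (\<exists>B. has_barcode s P B)"

definition barcode ::
  "('k::field \<Rightarrow> 'v::ab_group_add \<Rightarrow> 'v) \<Rightarrow> ('p::order, 'v) pmodule \<Rightarrow> 'p multiset" where
  "barcode s P = (THE B. has_barcode s P B)"

definition hilbert_decomposition ::
  "('k::field \<Rightarrow> 'v::ab_group_add \<Rightarrow> 'v) \<Rightarrow> (real^'n, 'v) pmodule \<Rightarrow>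
   ('k \<Rightarrow> 'w::ab_group_add \<Rightarrow> 'w) \<Rightarrow> (real^'n, 'w) pmodule \<Rightarrow> (real^'n \<Rightarrow> int) \<Rightarrow> bool" where
  "hilbert_decomposition s1 P s2 Q \<eta> \<longleftrightarrow>
     free_of_finite_rank s1 P \<and> free_of_finite_rank s2 Q \<and>
     (\<forall>r. \<eta> r = hilbert_function s1 P r - hilbert_function s2 Q r)"

definition minimal_hilbert_decomposition ::
  "('k::field \<Rightarrow> 'v::ab_group_add \<Rightarrow> 'v) \<Rightarrow> (real^'n, 'v) pmodule \<Rightarrow>
   ('k \<Rightarrow> 'w::ab_group_add \<Rightarrow> 'w) \<Rightarrow> (real^'n, 'w) pmodule \<Rightarrow> (real^'n \<Rightarrow> int) \<Rightarrow> bool" where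
  "minimal_hilbert_decomposition s1 P s2 Q \<eta> \<longleftrightarrow>
     hilbert_decomposition s1 P s2 Q \<eta> \<and>
     set_mset (barcode s1 P) \<inter> set_mset (barcode s2 Q) = {}"

(* The poset [l]^n as a subset of R^n; the order on real^'n is the product order. *)

definition grid :: "nat \<Rightarrow> (real^'n) set" where
  "grid l = {x. \<forall>a. \<exists>m<l. x $ a = real m}"

definition grid_floor :: "nat \<Rightarrow> real^'n \<Rightarrow> real^'n" where
  "grid_floor l r = (GREATEST t. t \<in> grid l \<and> t \<le> r)"

definition extension :: "nat \<Rightarrow> (real^'n, 'v::zero) pmodule \<Rightarrow> (real^'n, 'v) pmodule" where
  "extension l M =
     \<lparr>pm_space = (\<lambda>r. if \<exists>a. r $ a < 0 then {0} else pm_space M (grid_floor l r)),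
      pm_map = (\<lambda>r r' x. if \<exists>a. r $ a < 0 then 0
                         else pm_map M (grid_floor l r) (grid_floor l r') x)\<rparr>"

(* Basis is the canonical basis of real^'n. *)

definition hilbert_gamma ::
  "('k::field \<Rightarrow> 'v::ab_group_add \<Rightarrow> 'v) \<Rightarrow> nat \<Rightarrow> (real^'n, 'v) pmodule \<Rightarrow> real^'n \<Rightarrow> int" where
  "hilbert_gamma s l M i =
     (\<Sum>S | S \<subseteq> Basis \<and> i - \<Sum>S \<in> grid l. (-1) ^ card S * hilbert_function s M (i - \<Sum>S))"

end

theory Submission
  imports Defs
begin

text \<open>
  Free modules have Hilbert functions that merely count generators:
  the direct sum of the \<open>F\<^sub>i\<close> with multiplicities \<open>c i\<close> has dimension \<open>\<Sum>\<^sub>i\<^sub>\<le>\<^sub>r c i\<close> at \<open>r\<close>. Hence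
  \<open>(P, Q)\<close> is a Hilbert decomposition of the extension as soon as
  \<open>\<Sum>\<^sub>i\<^sub>\<le>\<^sub>r \<gamma> i\<close>, over the grid points \<open>i \<le> r\<close>, is the dimension of the extension at \<open>r\<close>.
  This is Moebius inversion on the grid (\<open>sum_alternating_differences_grid\<close>): for a grid
  point \<open>t\<close>, the dimension at a grid point \<open>j \<le> t\<close> enters the sum of the \<open>\<gamma> i\<close> with \<open>i \<le> t\<close>
  once with sign \<open>(-1)\<^bsup>card S\<^esup>\<close> for each set \<open>S\<close> of basis vectors such that \<open>j + \<Sum>S \<le> t\<close>.
  By integrality these are all the subsets of the set of directions in which \<open>j\<close> lies
  strictly below \<open>t\<close>. The signs cancel unless that set is empty, so only the term for
  \<open>j = t\<close> survives. A general \<open>r\<close> has no grid point below it or has the same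
  grid points below it as its floor (\<open>hilbert_function_extension\<close>).

  For minimality the barcodes have to be identified. The multiset
  of the \<open>i\<close> with multiplicity \<open>c i\<close> is a barcode (\<open>has_barcode_direct_sum_powers\<close>). It is the only
  one (\<open>barcode_eqI\<close>), since isomorphic modules have the same dimensions and the number of generators
  below each point determines a finite multiset (\<open>size_filter_le_inject\<close>). The two barcodes
  therefore lie in the sets where \<open>\<gamma> > 0\<close> and where \<open>\<gamma> < 0\<close>, which are disjoint.
\<close>

section \<open>Finite direct sums\<close>

lemma vector_space_fun_scale:
  assumes "vector_space s"
  shows "vector_space (fun_scale s :: 'k::field \<Rightarrow> ('b \<Rightarrow> 'v::ab_group_add) \<Rightarrow> _)"
proof -
  interpret vector_space s by fact
  show ?thesis
    by unfold_locales (auto simp: fun_scale_def fun_eq_iff scale_right_distrib scale_left_distrib)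
qed

lemma sum_fun_apply: "(\<Sum>a\<in>A. f a) b = (\<Sum>a\<in>A. f a b)"
  for f :: "'a \<Rightarrow> 'b \<Rightarrow> 'c::comm_monoid_add"
  by (induction A rule: infinite_finite_induct) auto

definition embed_at :: "'b \<Rightarrow> 'v \<Rightarrow> 'b \<Rightarrow> 'v::zero" where
  "embed_at b v = (\<lambda>b'. if b' = b then v else 0)"

lemma inj_embed_at: "inj (embed_at b)"
  by (auto simp: embed_at_def fun_eq_iff inj_def)

lemma linear_embed_at:
  assumes "vector_space s"
  shows "Vector_Spaces.linear s (fun_scale s) (embed_at b :: 'v::ab_group_add \<Rightarrow> _)"
proof -
  interpret V: vector_space s by fact
  interpret F: vector_space "fun_scale s" by (rule vector_space_fun_scale) fact
  show ?thesis
    by unfold_locales (auto simp: embed_at_def fun_scale_def fun_eq_iff)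
qed

lemma sum_embed_at:
  fixes x :: "'b \<Rightarrow> 'v::ab_group_add"
  assumes "finite B" "\<And>b. b \<notin> B \<Longrightarrow> x b = 0"
  shows "(\<Sum>b\<in>B. embed_at b (x b)) = x"
  using assms by (auto simp: fun_eq_iff sum_fun_apply embed_at_def)

text \<open>
  The union of the embedded families \<open>C b\<close> spans the direct sum of their spans. Together with
  the next lemma this turns bases of the summands into a basis of the sum, which
  gives both finite dimensionality and additivity of dimensions.
\<close>

lemma span_union_embed_at:
  fixes s :: "'k::field \<Rightarrow> 'v::ab_group_add \<Rightarrow> 'v"
  assumes "vector_space s" "finite B"
  shows "module.span (fun_scale s) (\<Union>b\<in>B. embed_at b ` C b) =
         {x. (\<forall>b\<in>B. x b \<in> module.span s (C b)) \<and> (\<forall>b. b \<notin> B \<longrightarrow> x b = 0)}"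
    (is "module.span _ ?D = ?W")
proof -
  interpret V: vector_space s by fact
  interpret F: vector_space "fun_scale s :: 'k \<Rightarrow> ('b \<Rightarrow> 'v) \<Rightarrow> _"
    by (rule vector_space_fun_scale) fact
  have "F.subspace ?W"
    by (auto simp: F.subspace_def fun_scale_def V.span_zero V.span_add V.span_scale)
  moreover have "?D \<subseteq> ?W"
    by (auto simp: embed_at_def V.span_base V.span_zero)
  ultimately have "F.span ?D \<subseteq> ?W"
    by (rule F.span_minimal[rotated])
  moreover have "x \<in> F.span ?D" if x: "x \<in> ?W" for x
  proof -
    have "embed_at b (x b) \<in> F.span ?D" if b: "b \<in> B" for b
    proof -
      interpret L: Vector_Spaces.linear s "fun_scale s" "embed_at b :: 'v \<Rightarrow> _"
        by (rule linear_embed_at) fact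
      have "embed_at b (x b) \<in> F.span (embed_at b ` C b)"
        using x b by (auto simp: L.span_image)
      also have "\<dots> \<subseteq> F.span ?D"
        using b by (intro F.span_mono) auto
      finally show ?thesis .
    qed
    then have "(\<Sum>b\<in>B. embed_at b (x b)) \<in> F.span ?D"
      by (rule F.span_sum)
    then show ?thesis
      using sum_embed_at[OF \<open>finite B\<close>, of x] x by auto
  qed
  ultimately show ?thesis by auto
qed

text \<open>
  Evaluating a vanishing linear combination at a coordinate \<open>b\<close> leaves a vanishing linear
  combination of \<open>C b\<close> alone. The embedded families are pairwise disjoint because \<open>0\<close> is the only
  vector that two embeddings can have in common, and \<open>0\<close> lies in no independent set.
\<close>

lemma independent_union_embed_at:
  fixes s :: "'k::field \<Rightarrow> 'v::ab_group_add \<Rightarrow> 'v"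
  assumes "vector_space s" "finite B"
    and C: "\<And>b. b \<in> B \<Longrightarrow> finite (C b) \<and> \<not> module.dependent s (C b)"
  shows "\<not> module.dependent (fun_scale s) (\<Union>b\<in>B. embed_at b ` C b)"
    and "card (\<Union>b\<in>B. embed_at b ` C b) = (\<Sum>b\<in>B. card (C b))"
proof -
  interpret V: vector_space s by fact
  interpret F: vector_space "fun_scale s :: 'k \<Rightarrow> ('b \<Rightarrow> 'v) \<Rightarrow> _"
    by (rule vector_space_fun_scale) fact
  let ?D = "\<Union>b\<in>B. embed_at b ` C b"
  have disj: "embed_at b ` C b \<inter> embed_at b' ` C b' = {}"
    if "b \<in> B" "b' \<in> B" "b \<noteq> b'" for b b'
  proof -
    have False if h: "v \<in> C b" "embed_at b v = embed_at b' w" for v w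
    proof -
      have "v = 0"
        using fun_cong[OF h(2), of b] \<open>b \<noteq> b'\<close> by (simp add: embed_at_def)
      then show False
        using C[OF \<open>b \<in> B\<close>] h(1) V.dependent_zero by auto
    qed
    then show ?thesis by blast
  qed
  show "card ?D = (\<Sum>b\<in>B. card (C b))"
    by (subst card_UN_disjoint)
       (use \<open>finite B\<close> C disj in \<open>auto simp: card_image inj_on_subset[OF inj_embed_at]\<close>)
  have "finite ?D" using \<open>finite B\<close> C by auto
  have "u (embed_at b w) = 0"
    if u: "(\<Sum>v\<in>?D. fun_scale s (u v) v) = 0" and b: "b \<in> B" and w: "w \<in> C b" for u b w
  proof -
    have "(\<Sum>v\<in>?D. fun_scale s (u v) v) =
        (\<Sum>b\<in>B. \<Sum>v\<in>embed_at b ` C b. fun_scale s (u v) v)"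
      by (rule sum.UNION_disjoint) (use \<open>finite B\<close> C disj in auto)
    also have "\<dots> = (\<Sum>b\<in>B. \<Sum>v\<in>C b. fun_scale s (u (embed_at b v)) (embed_at b v))"
      by (intro sum.cong refl) (simp add: sum.reindex inj_on_subset[OF inj_embed_at])
    finally have "(\<Sum>b\<in>B. \<Sum>v\<in>C b. fun_scale s (u (embed_at b v)) (embed_at b v)) b = 0"
      using u by (simp only: zero_fun_apply)
    also have "(\<Sum>b\<in>B. \<Sum>v\<in>C b. fun_scale s (u (embed_at b v)) (embed_at b v)) b = (\<Sum>b'\<in>B. if b' = b then \<Sum>v\<in>C b. s (u (embed_at b v)) v else 0)"
      unfolding sum_fun_apply
      by (intro sum.cong refl) (auto simp: fun_scale_def embed_at_def)
    also have "\<dots> = (\<Sum>v\<in>C b. s (u (embed_at b v)) v)"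
      using \<open>finite B\<close> b by simp
    finally have "(\<Sum>v\<in>C b. s (u (embed_at b v)) v) = 0" .
    moreover have "finite (C b)" "V.independent (C b)"
      using C[OF b] by auto
    ultimately show ?thesis
      using w V.dependent_finite[of "C b"] by auto
  qed
  then show "\<not> F.dependent ?D"
    unfolding F.dependent_finite[OF \<open>finite ?D\<close>] by blast
qed

lemma pm_space_direct_sum_finite:
  fixes N :: "'b \<Rightarrow> ('p, 'v::zero) pmodule"
  assumes "finite B"
  shows "pm_space (direct_sum B N) i =
         {x. (\<forall>b\<in>B. x b \<in> pm_space (N b) i) \<and> (\<forall>b. b \<notin> B \<longrightarrow> x b = 0)}"
proof -
  have "finite {b. x b \<noteq> 0}" if "\<forall>b. b \<notin> B \<longrightarrow> x b = 0" for x :: "'b \<Rightarrow> 'v"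
    by (rule finite_subset[OF _ assms]) (use that in auto)
  then show ?thesis by (auto simp: direct_sum_def)
qed

lemma pm_map_direct_sum:
  "pm_map (direct_sum B N) i j x b = (if b \<in> B then pm_map (N b) i j (x b) else 0)"
  by (simp add: direct_sum_def)

lemma (in persistence_module) finite_basis_pm_space:
  assumes "i \<in> I"
  obtains C where "finite C" "independent C" "pm_space M i = span C"
proof -
  obtain B where B: "finite B" "pm_space M i = span B"
    using finite_dim_pm_space[OF assms] by blast
  obtain C where C: "C \<subseteq> B" "independent C" "B \<subseteq> span C"
    by (rule maximal_independent_subset)
  have "span B = span C"
    using C by (metis span_mono span_span subset_antisym)
  with B C show thesis
    by (intro that[of C]) (auto intro: finite_subset)
qed

lemma persistence_module_direct_sum:
  fixes N :: "'b \<Rightarrow> ('p::order, 'v::ab_group_add) pmodule"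
  assumes "vector_space s" "finite B"
    and N: "\<And>b. b \<in> B \<Longrightarrow> persistence_module s I (N b)"
  shows "persistence_module (fun_scale s) I (direct_sum B N)"
proof -
  interpret F: vector_space "fun_scale s :: _ \<Rightarrow> ('b \<Rightarrow> 'v) \<Rightarrow> _"
    by (rule vector_space_fun_scale) fact
  note space = pm_space_direct_sum_finite[OF \<open>finite B\<close>, of N]
  have span: "\<exists>D. finite D \<and> pm_space (direct_sum B N) i = F.span D" if i: "i \<in> I" for i
  proof -
    have "\<exists>C. finite C \<and> pm_space (N b) i = module.span s C" if "b \<in> B" for b
      using persistence_module.finite_dim_pm_space[OF N[OF that] i] by blast
    then obtain C where C: "\<And>b. b \<in> B \<Longrightarrow> finite (C b)"
        "\<And>b. b \<in> B \<Longrightarrow> pm_space (N b) i = module.span s (C b)"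
      by metis
    have "pm_space (direct_sum B N) i = F.span (\<Union>b\<in>B. embed_at b ` C b)"
      unfolding space span_union_embed_at[OF assms(1,2)] using C by auto
    moreover have "finite (\<Union>b\<in>B. embed_at b ` C b)"
      using C \<open>finite B\<close> by auto
    ultimately show ?thesis by blast
  qed
  show ?thesis
  proof
    show "F.subspace (pm_space (direct_sum B N) i)" if "i \<in> I" for i
      using span[OF that] by auto
    show "\<exists>D. finite D \<and> pm_space (direct_sum B N) i = F.span D" if "i \<in> I" for i
      by (rule span) fact
    show "linear_map_on (fun_scale s) (fun_scale s) (pm_space (direct_sum B N) i)
        (pm_space (direct_sum B N) j) (pm_map (direct_sum B N) i j)"
      if ij: "i \<in> I" "j \<in> I" "i \<le> j" for i j
    proof -
      interpret V: vector_space s by fact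
      have "linear_map_on s s (pm_space (N b) i) (pm_space (N b) j) (pm_map (N b) i j)"
        if "b \<in> B" for b
        using persistence_module.linear_pm_map[OF N[OF that]] ij by auto
      then show ?thesis
        by (auto simp: linear_map_on_def space pm_map_direct_sum fun_scale_def fun_eq_iff
            image_subset_iff)
    qed
    show "pm_map (direct_sum B N) i i x = x"
      if "i \<in> I" "x \<in> pm_space (direct_sum B N) i" for i x
      using that persistence_module.pm_map_id[OF N]
      by (auto simp: space pm_map_direct_sum fun_eq_iff)
    show "pm_map (direct_sum B N) j k (pm_map (direct_sum B N) i j x) =
        pm_map (direct_sum B N) i k x"
      if "i \<in> I" "j \<in> I" "k \<in> I" "i \<le> j" "j \<le> k" "x \<in> pm_space (direct_sum B N) i" for i j k x
      using that persistence_module.pm_map_comp[OF N]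
      by (auto simp: space pm_map_direct_sum fun_eq_iff)
  qed
qed

lemma hilbert_function_direct_sum:
  fixes N :: "'b \<Rightarrow> ('p::order, 'v::ab_group_add) pmodule"
  assumes "vector_space s" "finite B"
    and N: "\<And>b. b \<in> B \<Longrightarrow> persistence_module s I (N b)" and i: "i \<in> I"
  shows "hilbert_function (fun_scale s) (direct_sum B N) i = (\<Sum>b\<in>B. hilbert_function s (N b) i)"
proof -
  interpret V: vector_space s by fact
  interpret F: vector_space "fun_scale s :: _ \<Rightarrow> ('b \<Rightarrow> 'v) \<Rightarrow> _"
    by (rule vector_space_fun_scale) fact
  have "\<exists>C. finite C \<and> V.independent C \<and> pm_space (N b) i = V.span C" if "b \<in> B" for b
    using persistence_module.finite_basis_pm_space[OF N[OF that] i] by metis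
  then obtain C where C: "\<And>b. b \<in> B \<Longrightarrow> finite (C b) \<and> V.independent (C b)"
      and CN: "\<And>b. b \<in> B \<Longrightarrow> pm_space (N b) i = V.span (C b)"
    by metis
  let ?D = "\<Union>b\<in>B. embed_at b ` C b"
  have "pm_space (direct_sum B N) i = F.span ?D"
    unfolding pm_space_direct_sum_finite[OF \<open>finite B\<close>] span_union_embed_at[OF assms(1,2)]
    using CN by auto
  then have "F.dim (pm_space (direct_sum B N) i) = (\<Sum>b\<in>B. card (C b))"
    using independent_union_embed_at[OF assms(1,2) C]
    by (simp add: F.dim_eq_card_independent)
  also have "\<dots> = (\<Sum>b\<in>B. V.dim (pm_space (N b) i))"
    using C CN by (intro sum.cong) (auto simp: V.dim_eq_card_independent)
  finally show ?thesis by (simp add: hilbert_function_def)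
qed

section \<open>Free modules and their barcodes\<close>

lemma persistence_module_free_gen:
  "persistence_module ((*) :: 'k \<Rightarrow> _) UNIV (free_gen i :: ('p::order, 'k::field) pmodule)"
proof
  show "\<exists>B. finite B \<and> pm_space (free_gen i :: ('p, 'k) pmodule) j = vector_space_over_itself.span B"
    for j
    by (cases "i \<le> j")
       (auto simp: free_gen_def vector_space_over_itself.span_singleton intro: exI[of _ "{1}"] exI[of _ "{}"])
qed (auto simp: free_gen_def linear_map_on_def vector_space_over_itself.subspace_def
    dest: order_trans)

lemma hilbert_function_free_gen:
  "hilbert_function (*) (free_gen i :: ('p::order, 'k::field) pmodule) r = of_bool (i \<le> r)"
proof -
  have "vector_space_over_itself.dim {0 :: 'k} = 0"
    using vector_space_over_itself.dim_eq_card_independent[of "{} :: 'k set"]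
      vector_space_over_itself.dim_span[of "{} :: 'k set"] by simp
  then show ?thesis
    by (simp add: hilbert_function_def free_gen_def)
qed

lemma persistence_module_pm_power_free_gen:
  "persistence_module (fun_scale ((*) :: 'k \<Rightarrow> _)) UNIV
     (pm_power (free_gen i :: ('p::order, 'k::field) pmodule) m)"
  unfolding pm_power_def
  by (rule persistence_module_direct_sum)
     (simp_all add: persistence_module_free_gen vector_space_over_itself.vector_space_axioms)

lemma hilbert_function_pm_power_free_gen:
  "hilbert_function (fun_scale (*)) (pm_power (free_gen i :: ('p::order, 'k::field) pmodule) m) r =
   int m * of_bool (i \<le> r)"
  unfolding pm_power_def
  by (subst hilbert_function_direct_sum[where I = UNIV])
     (simp_all add: persistence_module_free_gen vector_space_over_itself.vector_space_axioms
       hilbert_function_free_gen)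

lemma count_index_set_Sigma:
  "{(i, m). m < count B i} = (SIGMA i:set_mset B. {..<count B i})"
  by (auto simp: count_greater_zero_iff[symmetric] simp del: count_greater_zero_iff)

text \<open>
  The Hilbert function of a free module counts the generators below a point; this is what
  makes barcodes recoverable from dimensions.
\<close>

lemma hilbert_function_free_on:
  "hilbert_function (fun_scale (*)) (free_on B :: ('p::order, 'p \<times> nat \<Rightarrow> 'k::field) pmodule) r =
   int (size (filter_mset (\<lambda>i. i \<le> r) B))"
proof -
  have fin: "finite {(i, m). m < count B i}"
    by (auto simp: count_index_set_Sigma)
  have "hilbert_function (fun_scale (*)) (free_on B :: ('p, 'p \<times> nat \<Rightarrow> 'k) pmodule) r =
     (\<Sum>p\<in>{(i, m). m < count B i}. hilbert_function (*)
        ((case p of (i, m) \<Rightarrow> free_gen i) :: ('p, 'k) pmodule) r)"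
    unfolding free_on_def
    by (rule hilbert_function_direct_sum[where I = UNIV])
       (auto simp: fin persistence_module_free_gen vector_space_over_itself.vector_space_axioms)
  also have "\<dots> = (\<Sum>(i, m)\<in>(SIGMA i:set_mset B. {..<count B i}). of_bool (i \<le> r))"
    unfolding count_index_set_Sigma
    by (intro sum.cong) (auto simp: hilbert_function_free_gen)
  also have "\<dots> = (\<Sum>i\<in>set_mset B. int (count B i) * of_bool (i \<le> r))"
    by (subst sum.Sigma[symmetric]) auto
  also have "\<dots> = (\<Sum>i\<in>set_mset (filter_mset (\<lambda>i. i \<le> r) B). int (count B i))"
    by (intro sum.mono_neutral_cong_right) auto
  also have "\<dots> = int (size (filter_mset (\<lambda>i. i \<le> r) B))"
    by (simp add: size_multiset_overloaded_eq)
  finally show ?thesis .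
qed

text \<open>
  A map that is linear only on the subspace \<open>V\<close> is replaced by one that is linear on the whole
  ambient space and agrees with it on a basis of \<open>V\<close>, hence on \<open>V\<close>; such a map
  carries the basis of \<open>V\<close> to a basis of \<open>W\<close>.
\<close>

lemma dim_linear_bij_image:
  fixes s1 :: "'k::field \<Rightarrow> 'v::ab_group_add \<Rightarrow> 'v" and s2 :: "'k \<Rightarrow> 'w::ab_group_add \<Rightarrow> 'w"
  assumes "vector_space s1" "vector_space s2" and V: "module.subspace s1 V"
    and f: "linear_map_on s1 s2 V W f" "bij_betw f V W"
  shows "vector_space.dim s2 W = vector_space.dim s1 V"
proof -
  interpret vector_space_pair s1 s2
    using assms(1,2) by (simp add: vector_space_pair_def)
  obtain B where B: "B \<subseteq> V" "vs1.independent B" "V \<subseteq> vs1.span B" "card B = vs1.dim V"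
    by (rule vs1.basis_exists)
  have VB: "V = vs1.span B"
    using B V by (auto dest: vs1.span_minimal)
  define g where "g = construct B f"
  interpret g: Vector_Spaces.linear s1 s2 g
    unfolding g_def by (rule linear_construct) fact
  have "g x = f x \<and> x \<in> V" if "x \<in> vs1.span B" for x
    using that
  proof (induction rule: vs1.span_induct_alt)
    case base
    have "f (s1 0 0) = s2 0 (f 0)"
      using f(1) V vs1.subspace_0 unfolding linear_map_on_def by blast
    then show ?case using V by (simp add: g.zero vs1.subspace_0)
  next
    case (step c b y)
    then have "b \<in> V" "g b = f b"
      using B construct_basis[OF B(2), of b f] by (auto simp: g_def)
    with step f(1) V show ?case
      by (auto simp: linear_map_on_def g.add g.scale vs1.subspace_add vs1.subspace_scale)
  qed
  then have gf: "g x = f x" if "x \<in> V" for x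
    using that VB by blast
  have inj: "inj_on g V"
    using f(2) gf by (auto simp: bij_betw_def inj_on_def)
  have "W = g ` V"
    using f(2) gf by (auto simp: bij_betw_def)
  then have "W = vs2.span (g ` B)"
    by (metis VB g.span_image)
  moreover have "vs2.independent (g ` B)"
    using g.independent_injective_image B(2) inj VB by metis
  ultimately have "vs2.dim W = card (g ` B)"
    by (simp add: vs2.dim_eq_card_independent)
  also have "\<dots> = card B"
    using inj B(1) by (intro card_image) (auto intro: inj_on_subset)
  finally show ?thesis using B(4) by simp
qed

lemma hilbert_function_pm_isomorphic:
  assumes "persistence_module s1 UNIV P" "vector_space s2" "pm_isomorphic s1 P s2 Q"
  shows "hilbert_function s2 Q r = hilbert_function s1 P r"
proof -
  interpret P: persistence_module s1 UNIV P by fact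
  show ?thesis
    using assms(3) unfolding pm_isomorphic_def hilbert_function_def
    by (metis dim_linear_bij_image P.vector_space_axioms assms(2) P.subspace_pm_space UNIV_I)
qed

text \<open>
  At a minimal point \<open>r\<close> where the multiplicities in \<open>B\<close> and \<open>C\<close> differ, the two multisets agree strictly
  below \<open>r\<close>, so the numbers of elements below or at \<open>r\<close> differ as well.
\<close>

lemma size_filter_le_inject:
  fixes B C :: "'p::order multiset"
  assumes eq: "\<And>r. size (filter_mset (\<lambda>i. i \<le> r) B) = size (filter_mset (\<lambda>i. i \<le> r) C)"
  shows "B = C"
proof (rule ccontr)
  assume "B \<noteq> C"
  define D where "D = {i. count B i \<noteq> count C i}"
  have "finite D"
    by (rule finite_subset[of _ "set_mset B \<union> set_mset C"]) (auto simp: D_def not_in_iff)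
  moreover have "D \<noteq> {}"
    using \<open>B \<noteq> C\<close> by (auto simp: D_def multiset_eq_iff)
  ultimately obtain r where r: "r \<in> D" "\<And>i. i \<in> D \<Longrightarrow> i \<le> r \<Longrightarrow> i = r"
    using finite_has_minimal by metis
  \<comment> \<open>Only the summand for \<open>r\<close> itself can make a difference.\<close>
  have split: "filter_mset (\<lambda>i. i \<le> r) A = filter_mset (\<lambda>i. i < r) A + replicate_mset (count A r) r"
    for A :: "'p multiset"
    by (auto simp: multiset_eq_iff order.order_iff_strict)
  have "filter_mset (\<lambda>i. i < r) B = filter_mset (\<lambda>i. i < r) C"
    using r(2) by (fastforce simp: multiset_eq_iff D_def)
  then have "count B r = count C r"
    using eq[of r] by (simp add: split)
  then show False using r(1) by (simp add: D_def)
qed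

lemma barcode_eqI:
  fixes s :: "'k::field \<Rightarrow> 'v::ab_group_add \<Rightarrow> 'v" and P :: "('p::order, 'v) pmodule"
  assumes P: "persistence_module s UNIV P" and B: "has_barcode s P B"
  shows "barcode s P = B"
  unfolding barcode_def
proof (rule the_equality)
  show "has_barcode s P B" by fact
next
  have vs: "vector_space (fun_scale (*) :: 'k \<Rightarrow> ('p \<times> nat \<Rightarrow> 'k) \<Rightarrow> _)"
    by (intro vector_space_fun_scale vector_space_over_itself.vector_space_axioms)
  fix C assume C: "has_barcode s P C"
  have "int (size (filter_mset (\<lambda>i. i \<le> r) A)) = hilbert_function s P r"
    if "has_barcode s P A" for A r
    using hilbert_function_pm_isomorphic[OF P vs] that
    unfolding has_barcode_def hilbert_function_free_on[where 'k = 'k, symmetric] by blast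
  then have "size (filter_mset (\<lambda>i. i \<le> r) C) = size (filter_mset (\<lambda>i. i \<le> r) B)" for r
    using B C by (metis of_nat_eq_iff)
  then show "C = B" by (rule size_filter_le_inject)
qed

text \<open>
  The isomorphism only uncurries: the generators of the nested direct sum are
  indexed by a point \<open>i\<close> and then by a copy number \<open>m < c i\<close>, those of the
  free module on a multiset by the pair \<open>(i, m)\<close>.
\<close>

lemma has_barcode_direct_sum_powers:
  fixes c :: "'p::order \<Rightarrow> nat"
  assumes A: "finite A"
  shows "has_barcode (fun_scale (fun_scale ((*) :: 'k::field \<Rightarrow> 'k \<Rightarrow> 'k)))
           (direct_sum A (\<lambda>i. pm_power (free_gen i) (c i))) (\<Sum>i\<in>A. replicate_mset (c i) i)"
proof -
  let ?P = "direct_sum A (\<lambda>i. pm_power (free_gen i) (c i)) :: ('p, 'p \<Rightarrow> nat \<Rightarrow> 'k) pmodule"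
  let ?B = "\<Sum>i\<in>A. replicate_mset (c i) i"
  let ?Q = "free_on ?B :: ('p, 'p \<times> nat \<Rightarrow> 'k) pmodule"
  let ?I = "{(i, m). i \<in> A \<and> m < c i}"
  have count: "count ?B i = (if i \<in> A then c i else 0)" for i
    using A by (simp add: count_sum)
  have I: "{(i, m). m < count ?B i} = ?I"
    by (auto simp: count split: if_splits)
  have Q: "?Q = direct_sum ?I (\<lambda>(i, m). free_gen i)"
    by (simp add: free_on_def I)
  have "?I = (SIGMA i:A. {..<c i})" by auto
  then have fin: "finite ?I" using A by simp
  have spaceP: "pm_space ?P r =
      {x. (\<forall>i m. (i, m) \<in> ?I \<longrightarrow> x i m \<in> pm_space (free_gen i) r) \<and>
          (\<forall>i m. (i, m) \<notin> ?I \<longrightarrow> x i m = 0)}" for r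
    by (auto simp: pm_space_direct_sum_finite A pm_power_def fun_eq_iff)
  have spaceQ: "pm_space ?Q r =
      {y. (\<forall>i m. (i, m) \<in> ?I \<longrightarrow> y (i, m) \<in> pm_space (free_gen i) r) \<and>
          (\<forall>i m. (i, m) \<notin> ?I \<longrightarrow> y (i, m) = 0)}" for r
    unfolding Q pm_space_direct_sum_finite[OF fin] by auto
  show ?thesis
    unfolding has_barcode_def pm_isomorphic_def
  proof (intro exI[of _ "\<lambda>_. case_prod"] conjI allI impI ballI)
    fix r
    show "bij_betw case_prod (pm_space ?P r) (pm_space ?Q r)"
      unfolding spaceP spaceQ by (rule bij_betwI[of _ _ _ curry]) auto
    show "linear_map_on (fun_scale (fun_scale (*))) (fun_scale (*)) (pm_space ?P r) (pm_space ?Q r)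
        case_prod"
      unfolding linear_map_on_def spaceP spaceQ by (auto simp: fun_scale_def fun_eq_iff)
  next
    fix r r' :: 'p and x
    show "case_prod (pm_map ?P r r' x) = pm_map ?Q r r' (case_prod x)"
      unfolding Q by (auto simp: fun_eq_iff pm_map_direct_sum pm_power_def)
  qed
qed

section \<open>The grid\<close>

lemma finite_grid: "finite (grid l :: (real^'n) set)"
proof (rule finite_subset)
  show "(grid l :: (real^'n) set) \<subseteq>
      (\<lambda>f. \<chi> a. real (f a)) ` (PiE (UNIV :: 'n set) (\<lambda>_. {..<l}))"
  proof
    fix x :: "real^'n" assume "x \<in> grid l"
    then obtain f where f: "\<And>a. f a < l \<and> x $ a = real (f a)"
      unfolding grid_def mem_Collect_eq by metis
    then have "x = (\<chi> a. real (f a))" "f \<in> PiE UNIV (\<lambda>_. {..<l})"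
      by (auto simp: vec_eq_iff)
    then show "x \<in> (\<lambda>f. \<chi> a. real (f a)) ` (PiE (UNIV :: 'n set) (\<lambda>_. {..<l}))"
      by blast
  qed
qed (intro finite_imageI finite_PiE, auto)

lemma grid_nonneg: "x \<in> grid l \<Longrightarrow> 0 \<le> x $ a"
  unfolding grid_def by (auto dest: spec[of _ a])

text \<open>
  The greatest grid point below \<open>r\<close> is obtained by rounding each coordinate down and
  capping it at \<open>l - 1\<close>; that it exists gives meaning to the \<open>GREATEST\<close> in the definition of
  the floor.
\<close>

lemma grid_floor_greatest:
  fixes r :: "real^'n"
  assumes l: "l \<ge> 1" and r: "\<And>a. 0 \<le> r $ a"
  shows "grid_floor l r \<in> grid l" and "grid_floor l r \<le> r"
    and "\<And>t. t \<in> grid l \<Longrightarrow> t \<le> r \<Longrightarrow> t \<le> grid_floor l r"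
proof -
  define u :: "real^'n" where "u = (\<chi> a. real (min (l - 1) (nat \<lfloor>r $ a\<rfloor>)))"
  have u_grid: "u \<in> grid l"
    unfolding grid_def u_def mem_Collect_eq
  proof
    fix a
    show "\<exists>m<l. (\<chi> a. real (min (l - 1) (nat \<lfloor>r $ a\<rfloor>))) $ a = real m"
      using l by (intro exI[of _ "min (l - 1) (nat \<lfloor>r $ a\<rfloor>)"]) auto
  qed
  have "real (nat \<lfloor>r $ a\<rfloor>) \<le> r $ a" for a
    using r[of a] by simp
  then have u_le: "u \<le> r"
    unfolding u_def less_eq_vec_def by (auto simp: of_nat_min intro: min.coboundedI2)
  have u_max: "t \<le> u" if t: "t \<in> grid l" "t \<le> r" for t
    unfolding less_eq_vec_def
  proof
    fix a
    obtain m where m: "m < l" "t $ a = real m"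
      using t(1) unfolding grid_def by auto
    have "t $ a \<le> r $ a" using t(2) by (simp add: less_eq_vec_def)
    then have "m \<le> nat \<lfloor>r $ a\<rfloor>" using m(2) by (simp add: le_nat_floor)
    then show "t $ a \<le> u $ a" using m by (simp add: u_def)
  qed
  have "grid_floor l r = u"
    unfolding grid_floor_def by (rule Greatest_equality) (use u_grid u_le u_max in auto)
  then show "grid_floor l r \<in> grid l" "grid_floor l r \<le> r"
    "\<And>t. t \<in> grid l \<Longrightarrow> t \<le> r \<Longrightarrow> t \<le> grid_floor l r"
    using u_grid u_le u_max by auto
qed

lemma sum_basis_component:
  assumes "S \<subseteq> (Basis :: (real^'n) set)"
  shows "(\<Sum>S) $ a = of_bool (axis a 1 \<in> S)"
proof -
  have "finite S" using assms finite_Basis by (rule finite_subset)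
  have "(\<Sum>S) $ a = (\<Sum>e\<in>S. e $ a)"
    by simp
  also have "\<dots> = (\<Sum>e\<in>S. if e = axis a 1 then 1 else 0)"
  proof (rule sum.cong)
    fix e assume "e \<in> S"
    then obtain b where "e = axis b 1"
      using assms by (auto simp: Basis_vec_def)
    then show "e $ a = (if e = axis a 1 then 1 else 0)"
      by (auto simp: axis_eq_axis) (simp add: axis_def)+
  qed simp
  also have "\<dots> = of_bool (axis a 1 \<in> S)"
    using \<open>finite S\<close> by simp
  finally show ?thesis .
qed

text \<open>
  Coordinates of grid points are natural numbers, so a coordinate of \<open>j\<close> that is strictly
  below that of \<open>t\<close> can be raised by \<open>1\<close> without passing \<open>t\<close>; and a point with natural coordinates
  below a grid point is a grid point. This shape of the admissible sets \<open>S\<close>, the power set of a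
  fixed set, is what makes the signs cancel.
\<close>

lemma grid_add_sum_basis_le_iff:
  fixes j t :: "real^'n"
  assumes S: "S \<subseteq> Basis" and j: "j \<in> grid l" "j \<le> t" and t: "t \<in> grid l"
  shows "j + \<Sum>S \<in> grid l \<and> j + \<Sum>S \<le> t \<longleftrightarrow> S \<subseteq> {e \<in> Basis. j \<bullet> e < t \<bullet> e}"
proof -
  obtain f where f: "\<And>a. f a < l \<and> j $ a = real (f a)"
    using j(1) unfolding grid_def mem_Collect_eq by metis
  obtain g where g: "\<And>a. g a < l \<and> t $ a = real (g a)"
    using t unfolding grid_def mem_Collect_eq by metis
  have fg: "f a \<le> g a" for a
    using j(2) f g by (auto simp: less_eq_vec_def)
  have comp: "(j + \<Sum>S) $ a = real (f a + of_bool (axis a 1 \<in> S))" for a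
    using f sum_basis_component[OF S, of a] by simp
  have sub: "S \<subseteq> {e \<in> Basis. j \<bullet> e < t \<bullet> e} \<longleftrightarrow> (\<forall>a. axis a 1 \<in> S \<longrightarrow> f a < g a)"
  proof -
    have "e \<in> S \<Longrightarrow> \<exists>a. e = axis a 1" for e
      using S by (auto simp: Basis_vec_def)
    moreover have "j \<bullet> axis a 1 < t \<bullet> axis a 1 \<longleftrightarrow> f a < g a" for a
      using f[of a] g[of a] by (simp add: inner_axis)
    moreover have "S \<subseteq> {e \<in> Basis. j \<bullet> e < t \<bullet> e} \<longleftrightarrow> (\<forall>e\<in>S. j \<bullet> e < t \<bullet> e)"
      using S by blast
    ultimately show ?thesis
      by blast
  qed
  have le: "j + \<Sum>S \<le> t \<longleftrightarrow> (\<forall>a. axis a 1 \<in> S \<longrightarrow> f a < g a)"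
    unfolding less_eq_vec_def comp using g fg by (auto simp: of_bool_def Suc_le_eq) 
  have "j + \<Sum>S \<in> grid l" if "j + \<Sum>S \<le> t"
    unfolding grid_def mem_Collect_eq
  proof
    fix a
    have "f a + of_bool (axis a 1 \<in> S) \<le> g a"
      using that comp[of a] g[of a] unfolding less_eq_vec_def by (metis of_nat_le_iff)
    then show "\<exists>m<l. (j + \<Sum>S) $ a = real m"
      using comp[of a] g[of a] by (metis le_less_trans)
  qed
  then show ?thesis using le sub by blast
qed

lemma sum_alternating_Pow:
  assumes "finite T"
  shows "(\<Sum>S\<in>Pow T. (-1) ^ card S) = (of_bool (T = {}) :: int)"
proof -
  have "(\<Sum>S\<in>Pow T. (-1) ^ card S) = (\<Prod>e\<in>T. (-1 :: int) + 1)"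
    by (subst prod_add[OF assms]) simp
  also have "\<dots> = of_bool (T = {})"
    using assms by (simp add: card_gt_0_iff)
  finally show ?thesis .
qed

text \<open>
  Moebius inversion on the grid: \<open>h\<close> is recovered by summing its alternating differences, with
  \<open>h\<close> read as \<open>0\<close> outside the grid. After the substitution
  \<open>j = i - \<Sum>S\<close> the coefficient of \<open>h j\<close> is an alternating sum over a power set.
\<close>

lemma sum_alternating_differences_grid:
  fixes h :: "real^'n \<Rightarrow> int"
  assumes t: "t \<in> grid l"
  shows "(\<Sum>i | i \<in> grid l \<and> i \<le> t. \<Sum>S | S \<subseteq> Basis \<and> i - \<Sum>S \<in> grid l.
            (-1) ^ card S * h (i - \<Sum>S)) = h t"
proof -
  let ?G = "{i \<in> grid l. i \<le> t}"
  have finG: "finite ?G" by (rule finite_subset[OF _ finite_grid]) auto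
  have le: "i - \<Sum>S \<le> t" if "i \<le> t" "S \<subseteq> Basis" for i and S :: "(real^'n) set"
    unfolding less_eq_vec_def
  proof
    fix a
    have "i $ a \<le> t $ a" using that(1) by (simp add: less_eq_vec_def)
    then show "(i - \<Sum>S) $ a \<le> t $ a"
      using sum_basis_component[OF that(2), of a] by simp
  qed
  have "(\<Sum>i\<in>?G. \<Sum>S | S \<subseteq> Basis \<and> i - \<Sum>S \<in> grid l. (-1) ^ card S * h (i - \<Sum>S)) =
      (\<Sum>(i, S)\<in>(SIGMA i:?G. {S. S \<subseteq> Basis \<and> i - \<Sum>S \<in> grid l}).
         (-1) ^ card S * h (i - \<Sum>S))"
    by (rule sum.Sigma) (use finG in auto)
  also have "\<dots> = (\<Sum>(j, S)\<in>(SIGMA j:?G. {S. S \<subseteq> Basis \<and> j + \<Sum>S \<in> grid l \<and> j + \<Sum>S \<le> t}).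
         (-1) ^ card S * h j)"
    by (rule sum.reindex_bij_witness[where i = "\<lambda>(j, S). (j + \<Sum>S, S)" and j = "\<lambda>(i, S). (i - \<Sum>S, S)"])
       (auto simp: le)
  also have "\<dots> = (\<Sum>j\<in>?G. \<Sum>S | S \<subseteq> Basis \<and> j + \<Sum>S \<in> grid l \<and> j + \<Sum>S \<le> t. (-1) ^ card S * h j)"
    by (rule sum.Sigma[symmetric]) (use finG in auto)
  also have "\<dots> = (\<Sum>j\<in>?G. if j = t then h j else 0)"
  proof (rule sum.cong)
    fix j assume j: "j \<in> ?G"
    let ?T = "{e \<in> Basis. j \<bullet> e < t \<bullet> e}"
    have "{S. S \<subseteq> Basis \<and> j + \<Sum>S \<in> grid l \<and> j + \<Sum>S \<le> t} = Pow ?T"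
      using grid_add_sum_basis_le_iff[of _ j l t] j t by blast
    then have "(\<Sum>S | S \<subseteq> Basis \<and> j + \<Sum>S \<in> grid l \<and> j + \<Sum>S \<le> t. (-1) ^ card S * h j) =
        (\<Sum>S\<in>Pow ?T. (-1) ^ card S) * h j"
      by (simp add: sum_distrib_right)
    also have "\<dots> = of_bool (?T = {}) * h j"
      by (subst sum_alternating_Pow) auto
    also have "?T = {} \<longleftrightarrow> j = t"
    proof
      assume T: "?T = {}"
      have "t $ a \<le> j $ a" for a
      proof -
        have "axis a 1 \<in> (Basis :: (real^'n) set)" by (auto simp: Basis_vec_def)
        with T show ?thesis by (auto simp: inner_axis not_less dest!: spec[of _ "axis a 1"])
      qed
      with j show "j = t" by (auto simp: less_eq_vec_def vec_eq_iff intro: antisym)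
    qed simp
    finally show "(\<Sum>S | S \<subseteq> Basis \<and> j + \<Sum>S \<in> grid l \<and> j + \<Sum>S \<le> t. (-1) ^ card S * h j) =
        (if j = t then h j else 0)"
      by simp
  qed simp
  also have "\<dots> = h t"
    using finG t by simp
  finally show ?thesis by simp
qed

text \<open>
  If a coordinate of \<open>r\<close> is negative, no grid point lies below \<open>r\<close> and both sides vanish; otherwise
  \<open>r\<close> and its floor have the same grid points below them, and inversion applies at the floor.
\<close>

lemma hilbert_function_extension:
  fixes M :: "(real^'n, 'v::ab_group_add) pmodule"
  assumes l: "l \<ge> 1" and "vector_space s"
  shows "hilbert_function s (extension l M) r = (\<Sum>i | i \<in> grid l \<and> i \<le> r. hilbert_gamma s l M i)"
proof -
  interpret vector_space s by fact
  show ?thesis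
  proof (cases "\<exists>a. r $ a < 0")
    case True
    then obtain a where a: "r $ a < 0" ..
    have "\<not> i \<le> r" if "i \<in> grid l" for i
      using grid_nonneg[OF that, of a] a by (auto simp: less_eq_vec_def not_le intro!: exI[of _ a])
    then have "{i. i \<in> grid l \<and> i \<le> r} = {}"
      by blast
    then have "(\<Sum>i | i \<in> grid l \<and> i \<le> r. hilbert_gamma s l M i) = 0"
      by (simp only: sum.empty)
    moreover have "dim {0 :: 'v} = 0"
      using dim_eq_card_independent[of "{}"] dim_span[of "{}"] independent_empty by simp
    ultimately show ?thesis
      using True unfolding hilbert_function_def extension_def by simp
  next
    case False
    then have r: "0 \<le> r $ a" for a by (simp add: not_less)
    note floor = grid_floor_greatest[OF l, of r, OF r]
    have "{i \<in> grid l. i \<le> r} = {i \<in> grid l. i \<le> grid_floor l r}"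
      using floor by (auto intro: order_trans)
    then have "(\<Sum>i | i \<in> grid l \<and> i \<le> r. hilbert_gamma s l M i) =
        hilbert_function s M (grid_floor l r)"
      unfolding hilbert_gamma_def
      by (simp add: sum_alternating_differences_grid[OF floor(1), of "hilbert_function s M"])
    also have "\<dots> = hilbert_function s (extension l M) r"
      using False by (simp add: hilbert_function_def extension_def)
    finally show ?thesis by simp
  qed
qed

section \<open>The minimal Hilbert decomposition\<close>

context
  fixes A :: "'p::order set" and c :: "'p \<Rightarrow> nat" and P :: "('p, 'p \<Rightarrow> nat \<Rightarrow> 'k::field) pmodule"
  defines "P \<equiv> direct_sum A (\<lambda>i. pm_power (free_gen i) (c i))"
  assumes A: "finite A"
begin

lemma persistence_module_direct_sum_powers:
  "persistence_module (fun_scale (fun_scale (*))) UNIV P"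
  unfolding P_def using A
  by (intro persistence_module_direct_sum persistence_module_pm_power_free_gen
      vector_space_fun_scale vector_space_over_itself.vector_space_axioms)

lemma free_direct_sum_powers: "free_of_finite_rank (fun_scale (fun_scale (*))) P"
  unfolding free_of_finite_rank_def
  using persistence_module_direct_sum_powers has_barcode_direct_sum_powers[OF A, of c]
  unfolding P_def by blast

lemma set_barcode_direct_sum_powers:
  "set_mset (barcode (fun_scale (fun_scale (*))) P) \<subseteq> A"
proof -
  have "barcode (fun_scale (fun_scale (*))) P = (\<Sum>i\<in>A. replicate_mset (c i) i)"
    using persistence_module_direct_sum_powers has_barcode_direct_sum_powers[OF A, of c]
    unfolding P_def by (rule barcode_eqI)
  then show ?thesis
    using A by (auto simp: set_mset_sum split: if_splits)
qed

lemma hilbert_function_direct_sum_powers: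
  "hilbert_function (fun_scale (fun_scale (*))) P r = (\<Sum>i | i \<in> A \<and> i \<le> r. int (c i))"
proof -
  have "hilbert_function (fun_scale (fun_scale (*))) P r = (\<Sum>i\<in>A. int (c i) * of_bool (i \<le> r))"
    unfolding P_def hilbert_function_pm_power_free_gen[where 'k = 'k, symmetric] using A
    by (intro hilbert_function_direct_sum[where I = UNIV] persistence_module_pm_power_free_gen
        vector_space_fun_scale vector_space_over_itself.vector_space_axioms) simp_all
  also have "\<dots> = (\<Sum>i | i \<in> A \<and> i \<le> r. int (c i))"
    using A by (intro sum.mono_neutral_cong_right) auto
  finally show ?thesis .
qed

end

theorem proposition7p3:
  fixes s :: "'k::field \<Rightarrow> 'v::ab_group_add \<Rightarrow> 'v"
    and l :: nat
    and M :: "(real^'n, 'v) pmodule"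
  assumes "l \<ge> 1"
    and "persistence_module s (grid l) M"
  shows "minimal_hilbert_decomposition
    (fun_scale (fun_scale ((*) :: 'k \<Rightarrow> 'k \<Rightarrow> 'k)))
    (direct_sum {i \<in> grid l. hilbert_gamma s l M i > 0}
       (\<lambda>i. pm_power (free_gen i) (nat (hilbert_gamma s l M i))))
    (fun_scale (fun_scale ((*) :: 'k \<Rightarrow> 'k \<Rightarrow> 'k)))
    (direct_sum {i \<in> grid l. hilbert_gamma s l M i < 0}
       (\<lambda>i. pm_power (free_gen i) (nat (- hilbert_gamma s l M i))))
    (hilbert_function s (extension l M))"
proof -
  let ?g = "hilbert_gamma s l M"
  let ?Pos = "{i \<in> grid l. ?g i > 0}" and ?Neg = "{i \<in> grid l. ?g i < 0}"
  let ?P = "direct_sum ?Pos (\<lambda>i. pm_power (free_gen i) (nat (?g i)))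
    :: (real^'n, real^'n \<Rightarrow> nat \<Rightarrow> 'k) pmodule"
  let ?Q = "direct_sum ?Neg (\<lambda>i. pm_power (free_gen i) (nat (- ?g i)))
    :: (real^'n, real^'n \<Rightarrow> nat \<Rightarrow> 'k) pmodule"
  let ?sc = "fun_scale (fun_scale ((*) :: 'k \<Rightarrow> 'k \<Rightarrow> 'k))
    :: 'k \<Rightarrow> (real^'n \<Rightarrow> nat \<Rightarrow> 'k) \<Rightarrow> (real^'n \<Rightarrow> nat \<Rightarrow> 'k)"
  interpret persistence_module s "grid l" M by fact
  have fin: "finite ?Pos" "finite ?Neg"
    by (rule finite_subset[OF _ finite_grid[of l]]; auto)+
  have "hilbert_function s (extension l M) r = hilbert_function ?sc ?P r - hilbert_function ?sc ?Q r"
    for r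
  proof -
    let ?G = "{i. i \<in> grid l \<and> i \<le> r}"
    have finG: "finite ?G" by (rule finite_subset[OF _ finite_grid]) auto
    \<comment> \<open>The truncation by \<open>nat\<close> separates the positive part of \<open>\<gamma>\<close> from the negative one.\<close>
    have "(\<Sum>i\<in>?G. ?g i) = (\<Sum>i\<in>?G. int (nat (?g i)) - int (nat (- ?g i)))"
      by (intro sum.cong) auto
    also have "\<dots> = (\<Sum>i\<in>?G. int (nat (?g i))) - (\<Sum>i\<in>?G. int (nat (- ?g i)))"
      by (rule sum_subtractf)
    also have "(\<Sum>i\<in>?G. int (nat (?g i))) = (\<Sum>i | i \<in> ?Pos \<and> i \<le> r. int (nat (?g i)))"
      using finG by (intro sum.mono_neutral_right) auto
    also have "(\<Sum>i\<in>?G. int (nat (- ?g i))) = (\<Sum>i | i \<in> ?Neg \<and> i \<le> r. int (nat (- ?g i)))"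
      using finG by (intro sum.mono_neutral_right) auto
    finally show ?thesis
      using hilbert_function_extension[OF assms(1) vector_space_axioms, of M r]
      by (simp only: hilbert_function_direct_sum_powers[OF fin(1)]
          hilbert_function_direct_sum_powers[OF fin(2)])
  qed
  moreover have "set_mset (barcode ?sc ?P) \<inter> set_mset (barcode ?sc ?Q) = {}"
    using set_barcode_direct_sum_powers[OF fin(1), where 'k = 'k and c = "\<lambda>i. nat (?g i)"]
      set_barcode_direct_sum_powers[OF fin(2), where 'k = 'k and c = "\<lambda>i. nat (- ?g i)"]
    by fastforce
  ultimately show ?thesis
    unfolding minimal_hilbert_decomposition_def hilbert_decomposition_def
    by (intro conjI allI free_direct_sum_powers fin)
qed

end
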